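(* Let $N\ge5$ be an integer, $m=\lfloor N/2\rfloor$, $M=N\gcd(2,N)$, and $$\Pi_N=\Bigl\{(e_1,\dots,e_m)\in\mathbb Z^m:\ \sum_{j=1}^me_j\equiv0\pmod{12},\ \sum_{j=1}^mj^2e_j\equiv0\pmod{M}\Bigr\}.$$ If $N=5$, the columns of $B_5=\begin{pmatrix}16&-5\\-4&5\end{pmatrix}$ form a $\mathbb Z$-basis of $\Pi_5$. If $N\ge6$, let $r_N\in\{0,1,2\}$ be the unique integer with $r_N\equiv2M\pmod3$, and put $a_N=\frac{-M+5r_N}3$, $b_N=\frac{M-8r_N}3$, $$\mathbf z_1=(16,-4,0,\dots,0)^T,\qquad \mathbf z_2=(a_N,b_N,r_N,0,\dots,0)^T.$$ For each $j\in\{3,\dots,m\}$ with $3\nmid j$ let $$\mathbf w_j=\left(\tfrac{j^2-4}3,\,-\tfrac{j^2-1}3,\,0,\dots,0,1,0,\dots,0\right)^T$$ with the $1$ in the $j$-th coordinate. Let $\{j\in\{3,\dots,m\}:3\mid j\}=\{j_1<\dots<j_r\}$ (nonempty since $m\ge3$), let $$\mathbf v_0=\left(j_1^2-4,\,-(j_1^2-1),\,0,\dots,0,3,0,\dots,0\right)^T$$ with the $3$ in the $j_1$-th coordinate, and for $2\le t\le r$ let $$\mathbf v_t=\left(\tfrac{j_t^2-j_1^2}3,\,-\tfrac{j_t^2-j_1^2}3,\,0,\dots,0,-1,0,\dots,0,1,0,\dots,0\right)^T$$ with $-1$ and $1$ in the $j_1$-th and $j_t$-th coordinates, respectively. Then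 $$\mathcal B_N=\{\mathbf z_1,\mathbf z_2\}\cup\{\mathbf w_j:3\le j\le m,\ 3\nmid j\}\cup\{\mathbf v_0\}\cup\{\mathbf v_t:2\le t\le r\}$$ is a $\mathbb Z$-basis of $\Pi_N$.
   Context: All notation is introduced in the claim. *)

theory Defs
  imports "Jordan_Normal_Form.VS_Connect" "HOL-Number_Theory.Cong"
begin

text \<open>
  The lattice \<open>\<int>\<^sup>n\<close> is \<^term>\<open>carrier_vec n :: int vec set\<close>. Coordinates of the type \<open>vec\<close> are counted
  from 0; the mathematics counts them from 1. All vectors below are given by functions of the
  1-based coordinate and converted by the following function.
\<close>

definition vec1 :: "nat \<Rightarrow> (nat \<Rightarrow> int) \<Rightarrow> int vec" where
  "vec1 n f = vec n (\<lambda>i. f (Suc i))"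

definition coord :: "int vec \<Rightarrow> nat \<Rightarrow> int" where
  "coord e j = e $ (j - 1)"

lemma vec1_carrier: "vec1 n f \<in> carrier_vec n"
  by (simp add: vec1_def)

lemma coord_vec1: "1 \<le> j \<Longrightarrow> j \<le> n \<Longrightarrow> coord (vec1 n f) j = f j"
  by (cases j) (simp_all add: vec1_def coord_def)

text \<open>
  \<open>vectorspace.basis\<close> of the library is available over fields only; this is the same notion for a
  sublattice \<open>L\<close> of the \<open>\<int>\<close>-module \<open>\<int>\<^sup>n\<close>.
\<close>

definition Z_basis :: "nat \<Rightarrow> int vec set \<Rightarrow> int vec set \<Rightarrow> bool" where
  "Z_basis n L B \<longleftrightarrow>
     B \<subseteq> L \<and>
     \<not> LinearCombinations.module.lin_dep class_ring (module_vec TYPE(int) n) B \<and>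
     LinearCombinations.module.span class_ring (module_vec TYPE(int) n) B = L"

definition m_of :: "nat \<Rightarrow> nat" where
  "m_of N = N div 2"

definition M_of :: "nat \<Rightarrow> int" where
  "M_of N = int (N * gcd 2 N)"

definition Pi_lattice :: "nat \<Rightarrow> int vec set" where
  "Pi_lattice N = {e \<in> carrier_vec (m_of N).
     [(\<Sum>j = 1..m_of N. coord e j) = 0] (mod 12) \<and>
     [(\<Sum>j = 1..m_of N. (int j)\<^sup>2 * coord e j) = 0] (mod M_of N)}"

definition B5 :: "int mat" where
  "B5 = mat_of_rows_list 2 [[16, -5],
                            [-4,  5]]"

definition r_of :: "nat \<Rightarrow> int" where
  "r_of N = (THE r. r \<in> {0, 1, 2} \<and> [r = 2 * M_of N] (mod 3))"

lemma r_of_ex1: "\<exists>!r. r \<in> {0, 1, 2} \<and> [r = 2 * M_of N] (mod (3 :: int))"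
proof (rule ex1I[of _ "(2 * M_of N) mod 3"])
  have "(2 * M_of N) mod 3 = 0 \<or> (2 * M_of N) mod 3 = 1 \<or> (2 * M_of N) mod 3 = 2"
    by presburger
  then show "(2 * M_of N) mod 3 \<in> {0, 1, 2} \<and> [(2 * M_of N) mod 3 = 2 * M_of N] (mod 3)"
    by (simp add: cong_def)
qed (auto simp: cong_def)

lemma r_of: "r_of N \<in> {0, 1, 2}" "[r_of N = 2 * M_of N] (mod 3)"
  using theI'[OF r_of_ex1[of N]] unfolding r_of_def by blast+

text \<open>All uses of \<open>div\<close> below are exact divisions; see the divisibility lemmas that follow them.\<close>

definition a_of :: "nat \<Rightarrow> int" where
  "a_of N = (- M_of N + 5 * r_of N) div 3"

definition b_of :: "nat \<Rightarrow> int" where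
  "b_of N = (M_of N - 8 * r_of N) div 3"

lemma three_dvd_a_b: "3 dvd - M_of N + 5 * r_of N" "3 dvd M_of N - 8 * r_of N"
  using r_of(2)[of N] unfolding cong_def by presburger+

definition z1_vec :: "nat \<Rightarrow> int vec" where
  "z1_vec N = vec1 (m_of N) ((\<lambda>_. 0)(1 := 16, 2 := -4))"

definition z2_vec :: "nat \<Rightarrow> int vec" where
  "z2_vec N = vec1 (m_of N) ((\<lambda>_. 0)(1 := a_of N, 2 := b_of N, 3 := r_of N))"

definition w_vec :: "nat \<Rightarrow> nat \<Rightarrow> int vec" where
  "w_vec N j = vec1 (m_of N)
     ((\<lambda>_. 0)(1 := ((int j)\<^sup>2 - 4) div 3, 2 := - (((int j)\<^sup>2 - 1) div 3), j := 1))"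

definition J3 :: "nat \<Rightarrow> nat set" where
  "J3 N = {j \<in> {3..m_of N}. 3 dvd j}"

text \<open>The indices \<open>j\<^sub>1 < \<dots> < j\<^sub>r\<close>, where \<open>r\<close> is \<^term>\<open>card (J3 N)\<close> (not to be confused with \<open>r\<^sub>N\<close>).\<close>

definition jj :: "nat \<Rightarrow> nat \<Rightarrow> nat" where
  "jj N t = sorted_list_of_set (J3 N) ! (t - 1)"

definition v0_vec :: "nat \<Rightarrow> int vec" where
  "v0_vec N = vec1 (m_of N)
     ((\<lambda>_. 0)(1 := (int (jj N 1))\<^sup>2 - 4, 2 := - ((int (jj N 1))\<^sup>2 - 1), jj N 1 := 3))"

definition v_vec :: "nat \<Rightarrow> nat \<Rightarrow> int vec" where
  "v_vec N t = vec1 (m_of N)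
     ((\<lambda>_. 0)(1 := ((int (jj N t))\<^sup>2 - (int (jj N 1))\<^sup>2) div 3,
              2 := - (((int (jj N t))\<^sup>2 - (int (jj N 1))\<^sup>2) div 3),
              jj N 1 := -1,
              jj N t := 1))"

lemma finite_J3: "finite (J3 N)"
  by (simp add: J3_def)

lemma J3_nonempty: "N \<ge> 6 \<Longrightarrow> J3 N \<noteq> {}"
  by (auto simp: J3_def m_of_def intro!: exI[of _ 3])

lemma jj_mem: "1 \<le> t \<Longrightarrow> t \<le> card (J3 N) \<Longrightarrow> jj N t \<in> J3 N"
  using nth_mem[of "t - 1" "sorted_list_of_set (J3 N)"] finite_J3[of N]
  by (simp add: jj_def)

lemma three_dvd_w:
  assumes "\<not> 3 dvd (j :: nat)"
  shows "3 dvd (int j)\<^sup>2 - 4" "3 dvd (int j)\<^sup>2 - 1"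
proof -
  have "int j mod 3 = 1 \<or> int j mod 3 = 2"
    using assms by presburger
  then have "((int j mod 3)\<^sup>2) mod 3 = 1"
    by auto
  then have "(int j)\<^sup>2 mod 3 = 1"
    by (simp add: power_mod)
  then show "3 dvd (int j)\<^sup>2 - 4" "3 dvd (int j)\<^sup>2 - 1"
    by presburger+
qed

lemma three_dvd_v:
  assumes "1 \<le> t" "t \<le> card (J3 N)"
  shows "3 dvd (int (jj N t))\<^sup>2 - (int (jj N 1))\<^sup>2"
proof -
  have "3 dvd jj N t" "3 dvd jj N 1"
    using jj_mem[of t N] jj_mem[of 1 N] assms by (auto simp: J3_def)
  then have "3 dvd int (jj N t)" "3 dvd int (jj N 1)"
    by presburger+
  then show ?thesis
    by (simp add: power2_eq_square)
qed

definition B_set :: "nat \<Rightarrow> int vec set" where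
  "B_set N = {z1_vec N, z2_vec N} \<union> {w_vec N j | j. 3 \<le> j \<and> j \<le> m_of N \<and> \<not> 3 dvd j} \<union> {v0_vec N}
     \<union> {v_vec N t | t. 2 \<le> t \<and> t \<le> card (J3 N)}"

end

theory Submission
  imports Defs
begin

text \<open>
  For \<open>e \<in> \<int>\<^sup>m\<close> write \<open>\<sigma>(e) = \<Sum> e\<^sub>j\<close> and \<open>\<tau>(e) = \<Sum> j\<^sup>2 e\<^sub>j\<close>, so that \<open>\<Pi>\<^sub>N\<close> is given by
  \<open>12 | \<sigma>(e)\<close> and \<open>M | \<tau>(e)\<close>. A vector is determined by \<open>\<sigma>\<close>, \<open>\<tau>\<close> and its coordinates from the third
  on, because \<open>e\<^sub>1 + e\<^sub>2\<close> and \<open>e\<^sub>1 + 4 e\<^sub>2\<close> determine \<open>e\<^sub>1\<close> and \<open>e\<^sub>2\<close> (lemma \<open>vec_eqI_sums\<close>).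

  Let \<open>N \<ge> 6\<close>. The least multiple of \<open>3\<close> in \<open>{3..m}\<close> is \<open>j\<^sub>1 = 3\<close>, and more generally \<open>j\<^sub>t = 3 t\<close>, so
  the proposed basis can be indexed by the coordinates: \<open>u\<^sub>1 = z\<^sub>1\<close>, \<open>u\<^sub>2 = z\<^sub>2\<close>, \<open>u\<^sub>3 = v\<^sub>0\<close>, and for
  \<open>j \<ge> 4\<close> the vector \<open>u\<^sub>j\<close> is \<open>v\<^sub>t\<close> with \<open>j = 3 t\<close> or \<open>w\<^sub>j\<close>. In the data \<open>\<sigma>\<close>, \<open>\<tau>\<close>, \<open>e\<^sub>3\<close>, \<open>e\<^sub>4\<close>, \<dots> this
  family is triangular (lemma \<open>basis_at_sums\<close>): the combination \<open>\<Sum> c\<^sub>j u\<^sub>j\<close> has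
  \<open>\<sigma> = 12 c\<^sub>1\<close>, \<open>\<tau> = M c\<^sub>2\<close>, \<open>k\<close>-th coordinate \<open>c\<^sub>k\<close> for \<open>k \<ge> 4\<close>, and third coordinate
  \<open>r\<^sub>N c\<^sub>2 + 3 c\<^sub>3 - S(c)\<close>, where \<open>S(c)\<close> is the sum of the \<open>c\<^sub>j\<close> with \<open>3 | j\<close> and \<open>j > 3\<close>. Independence is
  immediate. For spanning, given \<open>e \<in> \<Pi>\<^sub>N\<close> with \<open>\<sigma>(e) = 12 p\<close> and \<open>\<tau>(e) = M q\<close>, all coefficients are
  forced, and the only thing to check is that \<open>c\<^sub>3 = (e\<^sub>3 + S(e) - r\<^sub>N q) / 3\<close> is an integer. Since
  \<open>j\<^sup>2 - 1\<close> is congruent to \<open>-1\<close> or \<open>0\<close> modulo \<open>3\<close> according to whether \<open>3\<close> divides \<open>j\<close>,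
  \<open>M q - 12 p = \<Sum> (j\<^sup>2 - 1) e\<^sub>j\<close> is congruent to \<open>-(e\<^sub>3 + S(e))\<close>, and \<open>r\<^sub>N\<close> was chosen congruent to
  \<open>2 M\<close>, that is, to \<open>-M\<close>.

  For \<open>N = 5\<close> the same comparison of \<open>\<sigma>\<close> and \<open>\<tau>\<close> works with the two columns, whose values of
  \<open>(\<sigma>, \<tau>)\<close> are \<open>(12, 0)\<close> and \<open>(0, 15)\<close>.
\<close>

section \<open>Integer bases given by finite families\<close>

text \<open>The integer combination \<open>\<Sum>i\<in>I. c i \<cdot> u i\<close> in \<open>\<int>\<^sup>n\<close>, given by its coordinates (counted from 0).\<close>

definition int_comb :: "nat \<Rightarrow> ('i \<Rightarrow> int vec) \<Rightarrow> 'i set \<Rightarrow> ('i \<Rightarrow> int) \<Rightarrow> int vec" where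
  "int_comb n u I c = vec n (\<lambda>k. \<Sum>i\<in>I. c i * u i $ k)"

lemma int_comb_carrier: "int_comb n u I c \<in> carrier_vec n"
  by (simp add: int_comb_def)

lemma int_comb_single:
  assumes "finite I" "i \<in> I" "u i \<in> carrier_vec n"
  shows "int_comb n u I (\<lambda>k. if k = i then 1 else 0) = u i"
proof (rule eq_vecI)
  fix k assume "k < dim_vec (u i)"
  have "(\<Sum>j\<in>I. (if j = i then 1 else 0) * u j $ k) = (\<Sum>j\<in>I. if j = i then u j $ k else 0)"
    by (rule sum.cong) auto
  with assms \<open>k < dim_vec (u i)\<close>
  show "int_comb n u I (\<lambda>k. if k = i then 1 else 0) $ k = u i $ k"
    by (auto simp: int_comb_def)
qed (use assms in \<open>auto simp: int_comb_def\<close>)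

text \<open>
  Independence is required of the family, not of its image, so it also forces the \<open>u i\<close> to be distinct.
\<close>

lemma Z_basis_family:
  fixes u :: "'i \<Rightarrow> int vec"
  assumes fin: "finite I"
    and car: "\<And>i. i \<in> I \<Longrightarrow> u i \<in> carrier_vec n"
    and L: "L = range (int_comb n u I)"
    and indep: "\<And>c. int_comb n u I c = 0\<^sub>v n \<Longrightarrow> \<forall>i\<in>I. c i = 0"
  shows "inj_on u I" "Z_basis n L (u ` I)"
proof -
  interpret vec_module "TYPE(int)" n .
  show inj: "inj_on u I"
  proof (rule inj_onI, rule ccontr)
    fix i j assume ij: "i \<in> I" "j \<in> I" "u i = u j" "i \<noteq> j"
    let ?c = "\<lambda>k. (if k = i then 1 else 0) - (if k = j then 1 else 0) :: int"
    have "int_comb n u I ?c =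
      int_comb n u I (\<lambda>k. if k = i then 1 else 0) - int_comb n u I (\<lambda>k. if k = j then 1 else 0)"
      by (rule eq_vecI) (simp_all add: int_comb_def left_diff_distrib sum_subtractf)
    also have "\<dots> = 0\<^sub>v n"
      using ij car fin by (simp add: int_comb_single)
    finally have "?c i = 0"
      using indep ij(1) by blast
    with ij show False by simp
  qed
  have sub: "u ` I \<subseteq> carrier_vec n"
    using car by auto
  have lc: "lincomb a (u ` I) = int_comb n u I (a \<circ> u)" for a
  proof (rule eq_vecI)
    show "dim_vec (lincomb a (u ` I)) = dim_vec (int_comb n u I (a \<circ> u))"
      using sub fin lincomb_closed[of "u ` I" a] by (simp add: int_comb_def)
    show "lincomb a (u ` I) $ k = int_comb n u I (a \<circ> u) $ k"
      if "k < dim_vec (int_comb n u I (a \<circ> u))" for k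
    proof -
      have k: "k < n"
        using that by (simp add: int_comb_def)
      have "lincomb a (u ` I) $ k = (\<Sum>v\<in>u ` I. (a v \<cdot>\<^sub>v v) $ k)"
        unfolding lincomb_def using k sub by (intro finsum_index) auto
      also have "\<dots> = (\<Sum>i\<in>I. a (u i) * u i $ k)"
        using k carrier_vecD[OF car] by (auto simp: sum.reindex[OF inj] intro!: sum.cong)
      finally show ?thesis
        using k by (simp add: int_comb_def)
    qed
  qed
  have "\<forall>v\<in>u ` I. a v = 0" if zero: "lincomb a (u ` I) = 0\<^sub>v n" for a
  proof
    fix v assume "v \<in> u ` I"
    then obtain i where "i \<in> I" "v = u i" by blast
    then show "a v = 0"
      using indep[of "a \<circ> u"] zero unfolding lc by simp
  qed
  then have "lin_indpt (u ` I)"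
    using finite_lin_indpt2[OF finite_imageI[OF fin] sub] by blast
  moreover have "span (u ` I) = L"
  proof -
    have "int_comb n u I c = int_comb n u I ((\<lambda>v. c (inv_into I u v)) \<circ> u)" for c
      using inj by (auto simp: int_comb_def intro!: eq_vecI sum.cong)
    then show ?thesis
      using fin sub by (auto simp: finite_span lc L)
  qed
  moreover have "u ` I \<subseteq> L"
  proof
    fix v assume "v \<in> u ` I"
    then obtain i where i: "i \<in> I" "v = u i" by blast
    then have "v = int_comb n u I (\<lambda>k. if k = i then 1 else 0)"
      using int_comb_single[OF fin i(1) car] by simp
    then show "v \<in> L"
      unfolding L by blast
  qed
  ultimately show "Z_basis n L (u ` I)"
    unfolding Z_basis_def by blast
qed

section \<open>Coordinates and weighted sums\<close>

lemma coord_int_comb: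
  assumes "1 \<le> j" "j \<le> n"
  shows "coord (int_comb n u I c) j = (\<Sum>i\<in>I. c i * coord (u i) j)"
  using assms by (simp add: coord_def int_comb_def)

lemma weighted_sum_int_comb:
  "(\<Sum>j = 1..n. g j * coord (int_comb n u I c) j) =
   (\<Sum>i\<in>I. c i * (\<Sum>j = 1..n. g j * coord (u i) j))"
proof -
  have "(\<Sum>j = 1..n. g j * coord (int_comb n u I c) j) =
    (\<Sum>j = 1..n. \<Sum>i\<in>I. c i * (g j * coord (u i) j))"
    by (rule sum.cong) (auto simp: coord_int_comb sum_distrib_left mult_ac)
  also have "\<dots> = (\<Sum>i\<in>I. c i * (\<Sum>j = 1..n. g j * coord (u i) j))"
    by (subst sum.swap) (simp add: sum_distrib_left)
  finally show ?thesis .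
qed

lemma sum_split_first_two:
  fixes f :: "nat \<Rightarrow> int"
  assumes "2 \<le> n"
  shows "(\<Sum>j = 1..n. f j) = f 1 + f 2 + (\<Sum>j = 3..n. f j)"
  using assms by (simp add: sum.atLeast_Suc_atMost numeral_eq_Suc)

text \<open>
  The sums with weights \<open>1\<close> and \<open>j\<^sup>2\<close> see the first two coordinates through the matrix with rows
  \<open>(1, 1)\<close> and \<open>(1, 4)\<close>, which is invertible over the rationals.
\<close>

lemma vec_eqI_sums:
  assumes "e \<in> carrier_vec n" "e' \<in> carrier_vec n" "2 \<le> n"
    and "(\<Sum>j = 1..n. coord e j) = (\<Sum>j = 1..n. coord e' j)"
    and "(\<Sum>j = 1..n. (int j)\<^sup>2 * coord e j) = (\<Sum>j = 1..n. (int j)\<^sup>2 * coord e' j)"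
    and "\<And>j. 3 \<le> j \<Longrightarrow> j \<le> n \<Longrightarrow> coord e j = coord e' j"
  shows "e = e'"
proof (rule eq_vecI)
  have "coord e 1 + coord e 2 = coord e' 1 + coord e' 2"
    using assms(4,6) sum_split_first_two[OF \<open>2 \<le> n\<close>, of "coord e"]
      sum_split_first_two[OF \<open>2 \<le> n\<close>, of "coord e'"] by simp
  moreover have "coord e 1 + 4 * coord e 2 = coord e' 1 + 4 * coord e' 2"
    using assms(5,6) sum_split_first_two[OF \<open>2 \<le> n\<close>, of "\<lambda>j. (int j)\<^sup>2 * coord e j"]
      sum_split_first_two[OF \<open>2 \<le> n\<close>, of "\<lambda>j. (int j)\<^sup>2 * coord e' j"] by simp
  ultimately have "coord e 1 = coord e' 1" "coord e 2 = coord e' 2"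
    by linarith+
  then have all: "coord e j = coord e' j" if "1 \<le> j" "j \<le> n" for j
    using assms(6)[of j] that by (cases "j = 1"; cases "j = 2") auto
  show "e $ k = e' $ k" if "k < dim_vec e'" for k
    using all[of "Suc k"] that assms(2) by (simp add: coord_def)
qed (use assms in auto)

text \<open>
  Two rewrite rules evaluating a weighted sum over a vector of small support, one entry at a time. The
  lower bound is written \<open>Suc 0\<close>, the simplifier's normal form of \<open>1\<close>.
\<close>

lemma weighted_sum_vec1_zero: "(\<Sum>j = Suc 0..n. g j * coord (vec1 n (\<lambda>_. 0)) j) = 0"
  by (rule sum.neutral) (auto simp: coord_vec1)

lemma weighted_sum_vec1_upd:
  assumes "1 \<le> a" "a \<le> n"
  shows "(\<Sum>j = Suc 0..n. g j * coord (vec1 n (f(a := x))) j) =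
    (\<Sum>j = Suc 0..n. g j * coord (vec1 n f) j) + g a * (x - f a)"
proof -
  have "(\<Sum>j = Suc 0..n. g j * coord (vec1 n (f(a := x))) j) =
    (\<Sum>j = Suc 0..n. g j * coord (vec1 n f) j + (if j = a then g a * (x - f a) else 0))"
    by (rule sum.cong) (auto simp: coord_vec1 algebra_simps)
  then show ?thesis
    using assms by (simp add: sum.distrib)
qed

section \<open>The basis indexed by coordinates\<close>

lemma J3_eq: "J3 N = (\<lambda>t. 3 * t) ` {1..m_of N div 3}"
  by (auto simp: J3_def dvd_def image_iff)

lemma card_J3: "card (J3 N) = m_of N div 3"
  unfolding J3_eq by (subst card_image) (auto simp: inj_on_def)

lemma jj_eq:
  assumes "1 \<le> t" "t \<le> m_of N div 3"
  shows "jj N t = 3 * t"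
proof -
  let ?xs = "map (\<lambda>t. 3 * t) [1..<Suc (m_of N div 3)]"
  have "set ?xs = J3 N"
    unfolding J3_eq by (simp only: set_map set_upt atLeastLessThanSuc_atLeastAtMost)
  moreover have "sorted ?xs"
    by (simp add: sorted_map sorted_wrt_upt del: upt_Suc)
  moreover have "distinct ?xs"
    by (auto simp: distinct_map inj_on_def)
  ultimately have "sorted_list_of_set (J3 N) = ?xs"
    using sorted_list_of_set.idem_if_sorted_distinct by metis
  then show ?thesis
    using assms unfolding jj_def by (simp del: upt_Suc)
qed

text \<open>
  The vectors of the proposed basis, indexed by \<open>1..m\<close>: for \<open>j \<ge> 3\<close> the \<open>j\<close>-th one is the one attached
  to the coordinate \<open>j\<close>, with \<open>v\<^sub>0\<close> attached to \<open>j\<^sub>1 = 3\<close> and \<open>v\<^sub>t\<close> to \<open>j\<^sub>t = 3 t\<close>.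
\<close>

definition basis_at :: "nat \<Rightarrow> nat \<Rightarrow> int vec" where
  "basis_at N j = (if j = 1 then z1_vec N else if j = 2 then z2_vec N else if j = 3 then v0_vec N
     else if 3 dvd j then v_vec N (j div 3) else w_vec N j)"

lemma basis_at_carrier: "basis_at N j \<in> carrier_vec (m_of N)"
  by (simp add: basis_at_def z1_vec_def z2_vec_def v0_vec_def v_vec_def w_vec_def vec1_carrier)

lemma B_set_eq:
  assumes "3 \<le> m_of N"
  shows "B_set N = basis_at N ` {1..m_of N}"
proof
  show "basis_at N ` {1..m_of N} \<subseteq> B_set N"
  proof
    fix v assume "v \<in> basis_at N ` {1..m_of N}"
    then obtain j where j: "1 \<le> j" "j \<le> m_of N" "v = basis_at N j" by auto
    consider "j \<le> 3" | "3 < j" "3 dvd j" | "3 < j" "\<not> 3 dvd j" by linarith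
    then show "v \<in> B_set N"
    proof cases
      case 1
      with j show ?thesis by (auto simp: B_set_def basis_at_def)
    next
      case 2
      then have "2 \<le> j div 3" "j div 3 \<le> card (J3 N)"
        using j by (auto simp: card_J3 dvd_def intro: div_le_mono)
      with 2 j show ?thesis by (auto simp: B_set_def basis_at_def)
    next
      case 3
      with j show ?thesis by (auto simp: B_set_def basis_at_def)
    qed
  qed
  have "z1_vec N = basis_at N 1" "z2_vec N = basis_at N 2" "v0_vec N = basis_at N 3"
    by (simp_all add: basis_at_def)
  moreover have "w_vec N j = basis_at N j" if "3 \<le> j" "\<not> 3 dvd j" for j
    using that by (auto simp: basis_at_def)
  moreover have "v_vec N t = basis_at N (3 * t)" "3 * t \<in> {1..m_of N}"
    if "2 \<le> t" "t \<le> m_of N div 3" for t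
    using that by (auto simp: basis_at_def)
  ultimately show "B_set N \<subseteq> basis_at N ` {1..m_of N}"
    using assms unfolding B_set_def card_J3 by (auto intro!: image_eqI)
qed


text \<open>
  The value of an arbitrary linear functional \<open>e \<mapsto> \<Sum> g j \<cdot> e\<^sub>j\<close> on the basis vectors; the weights \<open>1\<close>,
  \<open>j\<^sup>2\<close> and the indicators of a single coordinate are used below.
\<close>

lemma basis_at_weighted_sum:
  fixes g :: "nat \<Rightarrow> int"
  assumes "3 \<le> m_of N" "1 \<le> i" "i \<le> m_of N"
  shows "(\<Sum>j = 1..m_of N. g j * coord (basis_at N i) j) =
    (if i = 1 then 16 * g 1 - 4 * g 2
     else if i = 2 then a_of N * g 1 + b_of N * g 2 + r_of N * g 3
     else if i = 3 then 5 * g 1 - 8 * g 2 + 3 * g 3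
     else if 3 dvd i then (((int i)\<^sup>2 - 9) div 3) * (g 1 - g 2) - g 3 + g i
     else ((int i)\<^sup>2 - 4) div 3 * g 1 - ((int i)\<^sup>2 - 1) div 3 * g 2 + g i)"
proof -
  have jj1: "jj N 1 = 3"
    using jj_eq[of 1 N] assms by (simp add: Suc_le_eq div_greater_zero_iff)
  have jji: "jj N (i div 3) = i" if "3 dvd i" "i \<noteq> 0"
    using jj_eq[of "i div 3" N] assms that by (auto simp: div_le_mono dvd_def)
  note upd = weighted_sum_vec1_upd weighted_sum_vec1_zero
  consider "i = 1" | "i = 2" | "i = 3" | "3 < i" "3 dvd i" | "3 < i" "\<not> 3 dvd i"
    using assms by linarith
  then show ?thesis
  proof cases
    case 1
    with assms show ?thesis by (simp add: basis_at_def z1_vec_def upd)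
  next
    case 2
    with assms show ?thesis by (simp add: basis_at_def z2_vec_def upd)
  next
    case 3
    with assms show ?thesis by (simp add: basis_at_def v0_vec_def upd jj1[simplified])
  next
    case 4
    with assms show ?thesis
      by (simp add: basis_at_def v_vec_def upd jj1[simplified] jji algebra_simps)
  next
    case 5
    with assms show ?thesis by (simp add: basis_at_def w_vec_def upd)
  qed
qed

text \<open>The triangular shape of the family with respect to \<open>\<sigma>\<close>, \<open>\<tau>\<close> and the coordinates from the third on.\<close>

lemma basis_at_sums:
  assumes "3 \<le> m_of N" "1 \<le> i" "i \<le> m_of N"
  shows "(\<Sum>j = 1..m_of N. coord (basis_at N i) j) = (if i = 1 then 12 else 0)"
    and "(\<Sum>j = 1..m_of N. (int j)\<^sup>2 * coord (basis_at N i) j) = (if i = 2 then M_of N else 0)"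
    and "coord (basis_at N i) 3 = (if i = 2 then r_of N else if i = 3 then 3
           else if 3 < i \<and> 3 dvd i then - 1 else 0)"
    and "3 < k \<Longrightarrow> k \<le> m_of N \<Longrightarrow> coord (basis_at N i) k = (if i = k then 1 else 0)"
proof -
  have a: "3 * a_of N = - M_of N + 5 * r_of N" and b: "3 * b_of N = M_of N - 8 * r_of N"
    using three_dvd_a_b by (simp_all add: a_of_def b_of_def)
  have w: "3 * (((int i)\<^sup>2 - 4) div 3) = (int i)\<^sup>2 - 4" "3 * (((int i)\<^sup>2 - 1) div 3) = (int i)\<^sup>2 - 1"
    if "\<not> 3 dvd i"
    using three_dvd_w[OF that] by simp_all
  have v: "3 * (((int i)\<^sup>2 - 9) div 3) = (int i)\<^sup>2 - 9" if "3 dvd i"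
  proof -
    have "3 dvd (int i)\<^sup>2 - 9"
      using that by (auto simp: power2_eq_square elim!: dvdE)
    then show ?thesis by simp
  qed
  show "(\<Sum>j = 1..m_of N. coord (basis_at N i) j) = (if i = 1 then 12 else 0)"
    using basis_at_weighted_sum[OF assms, of "\<lambda>_. 1"] a b w v by (auto split: if_splits)
  show "(\<Sum>j = 1..m_of N. (int j)\<^sup>2 * coord (basis_at N i) j) = (if i = 2 then M_of N else 0)"
    using basis_at_weighted_sum[OF assms, of "\<lambda>j. (int j)\<^sup>2"] a b w v by (auto split: if_splits)
  have "coord (basis_at N i) k = (\<Sum>j = 1..m_of N. (if j = k then 1 else 0) * coord (basis_at N i) j)"
    if "3 \<le> k" "k \<le> m_of N" for k
    using that sum.delta[of "{1..m_of N}" k "coord (basis_at N i)"]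
    by (simp add: if_distrib[of "\<lambda>x. x * _"] cong: if_cong)
  note coord_basis_at = this[unfolded basis_at_weighted_sum[OF assms]]
  show "coord (basis_at N i) 3 = (if i = 2 then r_of N else if i = 3 then 3
           else if 3 < i \<and> 3 dvd i then - 1 else 0)"
    using assms by (subst coord_basis_at) auto
  show "3 < k \<Longrightarrow> k \<le> m_of N \<Longrightarrow> coord (basis_at N i) k = (if i = k then 1 else 0)"
    using assms by (subst coord_basis_at) auto
qed

section \<open>The two cases\<close>

lemma Z_basis_ge_6:
  assumes "6 \<le> N"
  shows "Z_basis (m_of N) (Pi_lattice N) (basis_at N ` {1..m_of N})"
proof (rule Z_basis_family)
  let ?m = "m_of N"
  let ?I = "{1..?m}"
  let ?comb = "int_comb ?m (basis_at N) ?I"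
  have m: "3 \<le> ?m" and M: "M_of N > 0"
    using assms by (auto simp: m_of_def M_of_def)
  show "finite ?I" "basis_at N i \<in> carrier_vec ?m" for i
    by (simp_all add: basis_at_carrier)
  note gs = basis_at_sums[OF m]
  have sum1: "(\<Sum>j = 1..?m. coord (?comb c) j) = 12 * c 1" for c
  proof -
    have "(\<Sum>j = 1..?m. coord (?comb c) j) = (\<Sum>i\<in>?I. c i * (\<Sum>j = 1..?m. coord (basis_at N i) j))"
      using weighted_sum_int_comb[of "\<lambda>_. 1" ?m "basis_at N" ?I c] by simp
    also have "\<dots> = (\<Sum>i\<in>?I. if i = 1 then 12 * c i else 0)"
      by (rule sum.cong) (use gs(1) in auto)
    finally have "(\<Sum>j = 1..?m. coord (?comb c) j) = (\<Sum>i\<in>?I. if i = 1 then 12 * c i else 0)" .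
    then show ?thesis using m by simp
  qed
  have sum2: "(\<Sum>j = 1..?m. (int j)\<^sup>2 * coord (?comb c) j) = M_of N * c 2" for c
  proof -
    have "(\<Sum>j = 1..?m. (int j)\<^sup>2 * coord (?comb c) j) =
      (\<Sum>i\<in>?I. c i * (\<Sum>j = 1..?m. (int j)\<^sup>2 * coord (basis_at N i) j))"
      by (rule weighted_sum_int_comb)
    also have "\<dots> = (\<Sum>i\<in>?I. if i = 2 then M_of N * c i else 0)"
      by (rule sum.cong) (use gs(2) in auto)
    finally have "(\<Sum>j = 1..?m. (int j)\<^sup>2 * coord (?comb c) j) =
      (\<Sum>i\<in>?I. if i = 2 then M_of N * c i else 0)" .
    then show ?thesis using m by simp
  qed
  \<comment> \<open>The contribution of the vectors \<open>v\<^sub>t\<close>, \<open>t \<ge> 2\<close>, to the third coordinate, up to sign.\<close>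
  define S where "S f = (\<Sum>j = 4..?m. if 3 dvd j then f j else 0)" for f :: "nat \<Rightarrow> int"
  have coord3: "coord (?comb c) 3 = r_of N * c 2 + 3 * c 3 - S c" for c
  proof -
    have "coord (?comb c) 3 = (\<Sum>i\<in>?I. c i * coord (basis_at N i) 3)"
      using m by (intro coord_int_comb) auto
    also have "\<dots> = (\<Sum>i = 1..?m. c i * (if i = 2 then r_of N else if i = 3 then 3
           else if 3 < i \<and> 3 dvd i then - 1 else 0))"
      by (rule sum.cong) (auto simp: gs)
    also have "\<dots> = c 2 * r_of N + c 3 * 3 + (\<Sum>i = 4..?m. - (if 3 dvd i then c i else 0))"
      using m by (subst sum_split_first_two) (auto simp: sum.atLeast_Suc_atMost[of 3] intro!: sum.cong)
    finally show ?thesis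
      by (simp add: S_def sum_negf)
  qed
  have coordk: "coord (?comb c) k = c k" if "3 < k" "k \<le> ?m" for c k
  proof -
    have "coord (?comb c) k = (\<Sum>i\<in>?I. c i * coord (basis_at N i) k)"
      using that by (intro coord_int_comb) auto
    also have "\<dots> = (\<Sum>i\<in>?I. if i = k then c i else 0)"
      by (rule sum.cong) (use gs(4) that in auto)
    finally have "coord (?comb c) k = (\<Sum>i\<in>?I. if i = k then c i else 0)" .
    then show ?thesis using that by simp
  qed
  show "\<forall>i\<in>?I. c i = 0" if zero: "?comb c = 0\<^sub>v ?m" for c
  proof
    fix i assume i: "i \<in> ?I"
    have z: "coord (?comb c) j = 0" if "1 \<le> j" "j \<le> ?m" for j
      using that unfolding zero by (simp add: coord_def)
    have c: "c 1 = 0" "c 2 = 0" "\<And>k. 3 < k \<Longrightarrow> k \<le> ?m \<Longrightarrow> c k = 0"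
      using sum1[of c] sum2[of c] coordk[of _ c] z M by simp_all
    moreover have "S c = 0"
      using c(3) by (auto simp: S_def intro!: sum.neutral)
    ultimately have "c 3 = 0"
      using coord3[of c] z[of 3] m by simp
    with c i show "c i = 0"
      by (cases "i = 1"; cases "i = 2"; cases "i = 3") auto
  qed
  show "Pi_lattice N = range ?comb"
  proof (intro equalityI subsetI)
    fix e assume "e \<in> range ?comb"
    then obtain c where "e = ?comb c" by blast
    then show "e \<in> Pi_lattice N"
      unfolding Pi_lattice_def
      by (simp only: mem_Collect_eq sum1 sum2) (simp add: int_comb_carrier cong_0_iff)
  next
    fix e assume "e \<in> Pi_lattice N"
    then have e: "e \<in> carrier_vec ?m"
      and "12 dvd (\<Sum>j = 1..?m. coord e j)" "M_of N dvd (\<Sum>j = 1..?m. (int j)\<^sup>2 * coord e j)"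
      by (auto simp: Pi_lattice_def cong_0_iff)
    then obtain p q where p: "(\<Sum>j = 1..?m. coord e j) = 12 * p"
      and q: "(\<Sum>j = 1..?m. (int j)\<^sup>2 * coord e j) = M_of N * q"
      by (elim dvdE)
    \<comment> \<open>Each \<open>j\<^sup>2 - 1\<close> is \<open>-1\<close> modulo \<open>3\<close> if \<open>3\<close> divides \<open>j\<close>, and \<open>0\<close> otherwise.\<close>
    have "3 dvd (\<Sum>j = 1..?m. ((int j)\<^sup>2 - 1) * coord e j + (if 3 dvd j then coord e j else 0))"
    proof (rule dvd_sum)
      fix j
      show "3 dvd ((int j)\<^sup>2 - 1) * coord e j + (if 3 dvd j then coord e j else 0)"
      proof (cases "3 dvd j")
        case True
        then have "3 dvd (int j)\<^sup>2 * coord e j"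
          by (auto simp: power2_eq_square elim!: dvdE)
        with True show ?thesis by (simp add: algebra_simps)
      qed (simp add: three_dvd_w)
    qed
    also have "(\<Sum>j = 1..?m. ((int j)\<^sup>2 - 1) * coord e j + (if 3 dvd j then coord e j else 0)) =
      M_of N * q - 12 * p + (\<Sum>j = 1..?m. if 3 dvd j then coord e j else 0)"
      by (simp add: sum.distrib sum_subtractf left_diff_distrib p[simplified] q[simplified])
    also have "(\<Sum>j = 1..?m. if 3 dvd j then coord e j else 0) = coord e 3 + S (coord e)"
      using m unfolding S_def
      by (subst sum_split_first_two) (auto simp: sum.atLeast_Suc_atMost[of 3])
    finally have "3 dvd M_of N * q - 12 * p + (coord e 3 + S (coord e))" .
    moreover have "3 dvd (r_of N - 2 * M_of N) * q"
      using r_of(2)[of N] by (simp add: cong_iff_dvd_diff)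
    ultimately obtain k l where "M_of N * q - 12 * p + (coord e 3 + S (coord e)) = 3 * k"
      and "(r_of N - 2 * M_of N) * q = 3 * l"
      by (elim dvdE)
    then have "coord e 3 + S (coord e) - r_of N * q = 3 * (k - l - M_of N * q + 4 * p)"
      by (simp add: left_diff_distrib)
    then obtain t where t: "coord e 3 + S (coord e) - r_of N * q = 3 * t"
      by blast
    define c where "c = (coord e)(1 := p, 2 := q, 3 := t)"
    have "S c = S (coord e)"
      by (auto simp: S_def c_def intro!: sum.cong)
    then have "coord (?comb c) 3 = coord e 3"
      using t unfolding coord3 by (simp add: c_def)
    moreover have "coord (?comb c) k = coord e k" if "3 < k" "k \<le> ?m" for k
      using that unfolding coordk[OF that] by (simp add: c_def)
    ultimately have coord_eq: "coord (?comb c) k = coord e k" if "3 \<le> k" "k \<le> ?m" for k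
      using that by (cases "k = 3") auto
    have c12: "c 1 = p" "c 2 = q"
      by (simp_all add: c_def)
    have "?comb c = e"
    proof (rule vec_eqI_sums[OF int_comb_carrier e])
      show "2 \<le> ?m" using m by simp
    qed (use coord_eq in \<open>simp_all only: sum1 sum2 p q c12\<close>)
    then show "e \<in> range ?comb" by blast
  qed
qed

lemma Z_basis_B5:
  "distinct (cols B5)" "Z_basis (m_of 5) (Pi_lattice 5) (set (cols B5))"
proof -
  define u where "u i = col B5 i" for i
  have m: "m_of 5 = 2" and M: "M_of 5 = 5"
    by (simp_all add: m_of_def M_of_def)
  have B5: "B5 \<in> carrier_mat 2 2"
    by (rule carrier_matI) (simp_all add: B5_def mat_of_rows_list_def)
  have u: "u 0 $ 0 = 16" "u 0 $ Suc 0 = - 4" "u (Suc 0) $ 0 = - 5" "u (Suc 0) $ Suc 0 = 5"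
    by (simp_all add: u_def B5_def mat_of_rows_list_def)
  have cols: "cols B5 = map u [0..<2]"
    using B5 by (simp add: cols_def u_def)
  let ?comb = "int_comb 2 u {..<2}"
  have comb: "coord (?comb c) 1 = 16 * c 0 - 5 * c 1" "coord (?comb c) 2 = - 4 * c 0 + 5 * c 1" for c
    by (simp_all add: int_comb_def coord_def u numeral_2_eq_2)
  have sum: "(\<Sum>j = 1..2. f j) = f 1 + f 2" for f :: "nat \<Rightarrow> int"
    by (simp add: numeral_2_eq_2)
  have Pi: "Pi_lattice 5 = range ?comb"
  proof (intro equalityI subsetI)
    fix e assume "e \<in> range ?comb"
    then obtain c where "e = ?comb c" by blast
    then show "e \<in> Pi_lattice 5"
      by (simp add: Pi_lattice_def m M sum comb int_comb_carrier cong_0_iff del: One_nat_def)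
  next
    fix e assume "e \<in> Pi_lattice 5"
    then have e: "e \<in> carrier_vec 2"
      and "12 dvd coord e 1 + coord e 2" "5 dvd coord e 1 + 4 * coord e 2"
      by (simp_all add: Pi_lattice_def m M sum cong_0_iff del: One_nat_def)
    then obtain p q where p: "coord e 1 + coord e 2 = 12 * p" and q: "coord e 1 + 4 * coord e 2 = 5 * q"
      by (elim dvdE)
    \<comment> \<open>The difference \<open>3 e\<^sub>2 = 5 q - 12 p\<close> shows that \<open>q\<close> is a multiple of \<open>3\<close>.\<close>
    define t where "t = 2 * q - 4 * p - coord e 2"
    have "q = 3 * t"
      using p q by (simp add: t_def)
    define c where "c = (\<lambda>i::nat. if i = 0 then p else t)"
    have "?comb c = e"
      using p q e \<open>q = 3 * t\<close>
      by (intro vec_eqI_sums[of _ 2] int_comb_carrier) (simp_all add: sum comb c_def del: One_nat_def)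
    then show "e \<in> range ?comb" by blast
  qed
  have indep: "\<forall>i\<in>{..<2}. c i = 0" if zero: "?comb c = 0\<^sub>v 2" for c
  proof -
    have "coord (?comb c) 1 = 0" "coord (?comb c) 2 = 0"
      unfolding zero by (simp_all add: coord_def)
    then have "c 0 = 0 \<and> c 1 = 0"
      unfolding comb by linarith
    then show ?thesis by (auto simp: less_2_cases_iff)
  qed
  have "u i \<in> carrier_vec 2" if "i \<in> {..<2}" for i
    using col_dim[of B5 i] carrier_matD(1)[OF B5] by (simp only: u_def)
  from Z_basis_family[OF _ this Pi indep]
  show "distinct (cols B5)" "Z_basis (m_of 5) (Pi_lattice 5) (set (cols B5))"
    by (simp_all add: cols distinct_map m lessThan_atLeast0 del: upt_Suc)
qed

theorem lemma2p3:
  fixes N :: nat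
  assumes "N \<ge> 5"
  shows "(N = 5 \<longrightarrow> distinct (cols B5) \<and> Z_basis (m_of N) (Pi_lattice N) (set (cols B5))) \<and>
         (N \<ge> 6 \<longrightarrow> Z_basis (m_of N) (Pi_lattice N) (B_set N))"
proof -
  have "B_set N = basis_at N ` {1..m_of N}" if "N \<ge> 6"
    using that by (intro B_set_eq) (auto simp: m_of_def)
  then show ?thesis
    using Z_basis_B5 Z_basis_ge_6[of N] by auto
qed

end
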